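(* Let $\mathcal I,\mathcal J$ be ideals on $\omega$ and let $\mathcal F,\mathcal G\subseteq\omega^\omega$. If $\mathcal G$ contains the identity function, then $\mathfrak u(\mathcal I,\mathcal F,\mathcal J,\mathcal G)>|\mathcal F|$ if and only if there exists an ultrafilter $\mathcal U$ on $\omega$ such that $\mathcal I\not\le_{\mathcal F}\mathcal U^*$ and $\mathcal J\le_{\mathcal G}\mathcal U^*$.
   Context: An ideal on $\omega$ is a family of subsets of $\omega$ closed under finite unions and subsets, containing all finite sets and not containing $\omega$. Ultrafilters on $\omega$ contain all cofinite sets; $\mathcal U^*=\{\omega\setminus A:A\in\mathcal U\}$ is the dual ideal. For $\mathcal F\subseteq\omega^\omega$ and ideals $\mathcal I,\mathcal K$ on $\omega$, $\mathcal I\le_{\mathcal F}\mathcal K$ means that there is $f\in\mathcal F$ with $f^{-1}[B]\in\mathcal K$ for every $B\in\mathcal I$. For an ideal $\mathcal K$ on $\omega$ and $\mathcal A\subseteq\mathcal P(\omega)$ let $\mathcal K(\mathcal A)=\{B\subseteq\omega:\exists F\in[\mathcal A]^{<\omega}\ (B\setminus\bigcup F\in\mathcal K)\}$; it is an ideal exactly when $\omega\notin\mathcal K(\mathcal A)$. For a cardinal $\lambda\le\mathfrak c=2^{\aleph_0}$, $\mathcal I\preceq^\lambda_{\mathcal F,\mathcal G}\mathcal J$ means: for each ideal $\mathcal J'$ on $\omega$ with $\mathcal J\le_{\mathcal G}\mathcal J'$ there exists $\mathcal A\subseteq\mathcal P(\omega)$ with $|\mathcal A|<\lambda$ such that $\omega\notin\mathcal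 J'(\mathcal A)$ and $\mathcal I\le_{\mathcal F}\mathcal J'(\mathcal A)$. Finally $$\mathfrak u(\mathcal I,\mathcal F,\mathcal J,\mathcal G)=\min\left(\{\lambda\le\mathfrak c:\mathcal I\preceq^\lambda_{\mathcal F,\mathcal G}\mathcal J\}\cup\{\mathfrak c^+\}\right).$$ *)

theory Defs
  imports Main
begin

unbundle cardinal_syntax

definition ideal :: "nat set set \<Rightarrow> bool" where
  "ideal I \<longleftrightarrow>
     (\<forall>A. finite A \<longrightarrow> A \<in> I) \<and>
     (\<forall>A\<in>I. \<forall>B\<in>I. A \<union> B \<in> I) \<and>
     (\<forall>A\<in>I. \<forall>B. B \<subseteq> A \<longrightarrow> B \<in> I) \<and>
     UNIV \<notin> I"

text \<open>Ultrafilters are nonprincipal by convention: they contain every cofinite set.\<close>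

definition ultrafilter :: "nat set set \<Rightarrow> bool" where
  "ultrafilter U \<longleftrightarrow>
     {} \<notin> U \<and>
     (\<forall>A. finite (- A) \<longrightarrow> A \<in> U) \<and>
     (\<forall>A\<in>U. \<forall>B\<in>U. A \<inter> B \<in> U) \<and>
     (\<forall>A\<in>U. \<forall>B. A \<subseteq> B \<longrightarrow> B \<in> U) \<and>
     (\<forall>A. A \<in> U \<or> - A \<in> U)"

definition dual :: "nat set set \<Rightarrow> nat set set" where
  "dual U = {- A | A. A \<in> U}"

definition le_via :: "(nat \<Rightarrow> nat) set \<Rightarrow> nat set set \<Rightarrow> nat set set \<Rightarrow> bool" where
  "le_via F I K \<longleftrightarrow> (\<exists>f\<in>F. \<forall>B\<in>I. f -` B \<in> K)"

text \<open>The family generated by an ideal \<open>K\<close> and a family \<open>A\<close>; it need not be proper.\<close>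

definition extend :: "nat set set \<Rightarrow> nat set set \<Rightarrow> nat set set" where
  "extend K A = {B. \<exists>S. finite S \<and> S \<subseteq> A \<and> B - \<Union>S \<in> K}"

definition preceq ::
  "'l rel \<Rightarrow> (nat \<Rightarrow> nat) set \<Rightarrow> (nat \<Rightarrow> nat) set \<Rightarrow> nat set set \<Rightarrow> nat set set \<Rightarrow> bool" where
  "preceq l F G I J \<longleftrightarrow>
     (\<forall>J'. ideal J' \<and> le_via G J J' \<longrightarrow>
        (\<exists>A :: nat set set. |A| <o l \<and> UNIV \<notin> extend J' A \<and> le_via F I (extend J' A)))"

text \<open>Cardinals are represented, up to \<open>=o\<close>, by cardinal orders on subsets of the type
  \<open>nat set set\<close>. This type is large enough to represent every cardinal up to the successor of
  the continuum, finite ones included.\<close>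

abbreviation continuum :: "nat set rel" where
  "continuum \<equiv> |UNIV :: nat set set|"

lemma cardinal_le_representable:
  fixes r :: "'a rel"
  assumes "Card_order r" and "r \<le>o cardSuc continuum"
  shows "\<exists>l :: nat set set rel. Card_order l \<and> l =o r"
proof -
  obtain l :: "nat set set rel" where l: "r =o l"
    using assms(2) unfolding internalize_ordLeq[of r] by blast
  have "l =o r" using l by (rule ordIso_symmetric)
  moreover from this have "Card_order l" using Card_order_ordIso[OF assms(1)] by blast
  ultimately show ?thesis by blast
qed

text \<open>A least element of a set of cardinals; it exists for nonempty sets and is unique only up
  to \<open>=o\<close>.\<close>

definition min_card :: "'l rel set \<Rightarrow> 'l rel" where
  "min_card S = (SOME l. l \<in> S \<and> (\<forall>k\<in>S. l \<le>o k))"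

lemma min_card_least:
  assumes "S \<noteq> {}" and "\<forall>l\<in>S. Card_order l"
  shows "min_card S \<in> S" and "\<forall>k\<in>S. min_card S \<le>o k"
proof -
  have "\<exists>l. l \<in> S \<and> (\<forall>k\<in>S. l \<le>o k)"
    using exists_minim_Card_order[of S] assms by blast
  from someI_ex[OF this] show "min_card S \<in> S" and "\<forall>k\<in>S. min_card S \<le>o k"
    unfolding min_card_def by blast+
qed

definition u_card ::
  "nat set set \<Rightarrow> (nat \<Rightarrow> nat) set \<Rightarrow> nat set set \<Rightarrow> (nat \<Rightarrow> nat) set \<Rightarrow> nat set set rel" where
  "u_card I F J G =
     min_card ({l. Card_order l \<and> l \<le>o continuum \<and> preceq l F G I J} \<union> {cardSuc continuum})"

end

theory Submission
  imports Defs
begin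

text \<open>The left-hand side says that \<^term>\<open>preceq |F| F G I J\<close> fails: the relation is
  monotone in the cardinal parameter and \<^term>\<open>|F|\<close> is at most the continuum, so the
  minimum defining \<^const>\<open>u_card\<close> lies above \<^term>\<open>|F|\<close> exactly when the relation
  fails at \<^term>\<open>|F|\<close> (lemma \<open>less_u_card_iff\<close>).

  If \<^term>\<open>U\<close> is an ultrafilter as on the right-hand side, then \<^term>\<open>dual U\<close> is a maximal
  ideal: adjoining sets to it either changes nothing or makes it improper. Hence it is itself
  a witness against \<^term>\<open>preceq |F| F G I J\<close>.

  Conversely, let \<^term>\<open>J'\<close> be a witness against \<^term>\<open>preceq |F| F G I J\<close>. The members
  of \<^term>\<open>F\<close> are diagonalized against one by one along a well-order of type
  \<^term>\<open>|F|\<close>. When \<^term>\<open>f\<close> is reached, fewer than \<^term>\<open>|F|\<close> sets have been adjoined to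
  \<^term>\<open>J'\<close>, so \<^term>\<open>f\<close> does not reduce \<^term>\<open>I\<close> to the ideal generated so far, that is,
  \<^term>\<open>f -` B\<close> lies outside it for some \<^term>\<open>B \<in> I\<close>. Adjoining the complement
  \<^term>\<open>- (f -` B)\<close> keeps the ideal proper and prevents every larger proper ideal from
  containing \<^term>\<open>f -` B\<close> (lemma \<open>diagonal_family\<close>). Any maximal ideal above the final
  ideal is the dual of the desired ultrafilter.\<close>

section \<open>Ideals, extensions and ultrafilters\<close>

lemma mem_dual [simp]: "A \<in> dual U \<longleftrightarrow> - A \<in> U"
  unfolding dual_def by (auto intro: exI[of _ "- A"])

lemma extend_superset: "ideal K \<Longrightarrow> K \<subseteq> extend K A"
  unfolding extend_def by (auto intro!: exI[of _ "{}"])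

lemma family_subset_extend: "ideal K \<Longrightarrow> A \<subseteq> extend K A"
  unfolding extend_def ideal_def by (auto intro!: exI[of _ "{X}" for X])

lemma ideal_extend:
  assumes K: "ideal K" and proper: "UNIV \<notin> extend K A"
  shows "ideal (extend K A)"
proof -
  have down: "Y \<in> K" if "X \<in> K" "Y \<subseteq> X" for X Y
    using K that unfolding ideal_def by blast
  have "X \<union> Y \<in> extend K A" if "X \<in> extend K A" "Y \<in> extend K A" for X Y
  proof -
    from that obtain S T where S: "finite S" "S \<subseteq> A" "X - \<Union>S \<in> K"
      and T: "finite T" "T \<subseteq> A" "Y - \<Union>T \<in> K"
      unfolding extend_def by blast
    have "(X - \<Union>S) \<union> (Y - \<Union>T) \<in> K"
      using S T K unfolding ideal_def by blast
    then have "X \<union> Y - \<Union>(S \<union> T) \<in> K" by (rule down) blast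
    then show ?thesis
      using S T unfolding extend_def by (auto intro!: exI[of _ "S \<union> T"])
  qed
  moreover have "Y \<in> extend K A" if "X \<in> extend K A" "Y \<subseteq> X" for X Y
  proof -
    from that obtain S where S: "finite S" "S \<subseteq> A" "X - \<Union>S \<in> K"
      unfolding extend_def by blast
    have "Y - \<Union>S \<in> K" using S(3) by (rule down) (use that in blast)
    then show ?thesis using S unfolding extend_def by blast
  qed
  moreover have "X \<in> extend K A" if "finite X" for X
    using extend_superset[OF K] K that unfolding ideal_def by blast
  ultimately show ?thesis using proper unfolding ideal_def by blast
qed

lemma ideal_dual: "ultrafilter U \<Longrightarrow> ideal (dual U)"
  unfolding ideal_def ultrafilter_def by (auto simp: Compl_Un)

lemma ultrafilter_dual_ideal:
  assumes M: "ideal M" and prime: "\<And>A. A \<in> M \<or> - A \<in> M"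
  shows "ultrafilter (dual M)"
  unfolding ultrafilter_def
proof (intro conjI ballI allI impI)
  show "{} \<notin> dual M" using M unfolding ideal_def by simp
next
  fix A :: "nat set" assume "finite (- A)"
  then show "A \<in> dual M" using M unfolding ideal_def by simp
next
  fix A B assume "A \<in> dual M" "B \<in> dual M"
  then show "A \<inter> B \<in> dual M" using M unfolding ideal_def by (simp add: Compl_Int)
next
  fix A B assume "A \<in> dual M" "A \<subseteq> B"
  then have "- A \<in> M" "- B \<subseteq> - A" by auto
  then show "B \<in> dual M" using M unfolding ideal_def by auto
next
  fix A show "A \<in> dual M \<or> - A \<in> dual M" using prime[of A] by auto
qed

text \<open>An ultrafilter decides every set, and an ideal contains no set together with its
  complement, so nothing can be added to the dual ideal.\<close>

lemma dual_ultrafilter_maximal: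
  assumes U: "ultrafilter U" and K: "ideal K" and sub: "dual U \<subseteq> K"
  shows "K = dual U"
proof -
  have "A \<in> dual U" if "A \<in> K" for A
  proof (rule ccontr)
    assume "A \<notin> dual U"
    then have "- A \<in> dual U" using U unfolding ultrafilter_def by auto
    then have "A \<union> - A \<in> K" using K sub that unfolding ideal_def by blast
    then show False using K unfolding ideal_def by simp
  qed
  then show ?thesis using sub by blast
qed

lemma ideal_Union_chain:
  assumes "\<C> \<noteq> {}" and ideals: "\<And>K. K \<in> \<C> \<Longrightarrow> ideal K" and "subset.chain \<A> \<C>"
  shows "ideal (\<Union>\<C>)"
proof -
  have "X \<union> Y \<in> \<Union>\<C>" if "X \<in> \<Union>\<C>" "Y \<in> \<Union>\<C>" for X Y
  proof -
    from that obtain K L where KL: "K \<in> \<C>" "X \<in> K" "L \<in> \<C>" "Y \<in> L" by blast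
    then have "K \<subseteq> L \<or> L \<subseteq> K" using assms(3) by (meson subset_chain_def)
    then show ?thesis using KL ideals unfolding ideal_def by blast
  qed
  moreover have "Y \<in> \<Union>\<C>" if "X \<in> \<Union>\<C>" "Y \<subseteq> X" for X Y
    using that ideals unfolding ideal_def by blast
  moreover have "X \<in> \<Union>\<C>" if "finite X" for X
    using that assms(1) ideals unfolding ideal_def by blast
  moreover have "UNIV \<notin> \<Union>\<C>" using ideals unfolding ideal_def by blast
  ultimately show ?thesis unfolding ideal_def by blast
qed

text \<open>An ideal that is maximal by Zorn's lemma is prime: if it does not contain
  \<^term>\<open>- A\<close>, then adjoining \<^term>\<open>A\<close> leaves it proper, so it contains
  \<^term>\<open>A\<close> already.\<close>

lemma ideal_below_dual_ultrafilter:
  assumes K: "ideal K"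
  obtains U where "ultrafilter U" "K \<subseteq> dual U"
proof -
  let ?P = "{M. ideal M \<and> K \<subseteq> M}"
  have "\<exists>M\<in>?P. \<forall>L\<in>?P. M \<subseteq> L \<longrightarrow> L = M"
  proof (rule subset_Zorn_nonempty)
    show "?P \<noteq> {}" using K by blast
  next
    fix \<C> assume C: "\<C> \<noteq> {}" "subset.chain ?P \<C>"
    then have members: "\<And>L. L \<in> \<C> \<Longrightarrow> ideal L" "\<And>L. L \<in> \<C> \<Longrightarrow> K \<subseteq> L"
      unfolding subset_chain_def by auto
    have "ideal (\<Union>\<C>)" using C(1) members(1) C(2) by (rule ideal_Union_chain)
    moreover have "K \<subseteq> \<Union>\<C>" using C(1) members(2) by (meson Union_upper ex_in_conv order_trans)
    ultimately show "\<Union>\<C> \<in> ?P" by simp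
  qed
  then obtain M where M: "ideal M" "K \<subseteq> M"
    and maximal: "\<And>L. ideal L \<Longrightarrow> M \<subseteq> L \<Longrightarrow> L = M" by auto
  have "A \<in> M \<or> - A \<in> M" for A
  proof (cases "UNIV \<in> extend M {A}")
    case True
    then obtain S where S: "S \<subseteq> {A}" "UNIV - \<Union>S \<in> M" unfolding extend_def by blast
    from S(1) have "- A \<subseteq> UNIV - \<Union>S" by blast
    then have "- A \<in> M" using S(2) M(1) unfolding ideal_def by blast
    then show ?thesis by (rule disjI2)
  next
    case False
    have "M \<subseteq> extend M {A}" by (rule extend_superset[OF M(1)])
    then have "extend M {A} = M" by (rule maximal[OF ideal_extend[OF M(1) False]])
    then show ?thesis using family_subset_extend[OF M(1), of "{A}"] by simp
  qed
  then have "ultrafilter (dual M)" by (rule ultrafilter_dual_ideal[OF M(1)])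
  moreover have "K \<subseteq> dual (dual M)" using M(2) by auto
  ultimately show thesis by (rule that)
qed

section \<open>Comparing the cardinal with the size of the function family\<close>

lemma card_of_functions_le_continuum: "|F :: (nat \<Rightarrow> nat) set| \<le>o continuum"
proof -
  \<comment> \<open>A function is coded by its graph, and the graph by a set of numbers through pairing.\<close>
  have "inj (\<lambda>f :: nat \<Rightarrow> nat. {(n, f n) | n. True})"
    by (rule injI) (fastforce simp: set_eq_iff fun_eq_iff)
  then have "|UNIV :: (nat \<Rightarrow> nat) set| \<le>o |UNIV :: (nat \<times> nat) set set|"
    unfolding card_of_ordLeq[symmetric] by blast
  also have "|UNIV :: (nat \<times> nat) set set| \<le>o continuum"
  proof -
    obtain h :: "nat \<times> nat \<Rightarrow> nat" where h: "inj h"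
      using card_of_Times_same_infinite[OF infinite_UNIV_nat]
        card_of_ordLeq[of "UNIV :: (nat \<times> nat) set" "UNIV :: nat set"] ordIso_iff_ordLeq
      by auto
    then have "inj (image h)" by (intro injI) (simp only: inj_image_eq_iff)
    then show ?thesis unfolding card_of_ordLeq[symmetric] by blast
  qed
  finally have "|UNIV :: (nat \<Rightarrow> nat) set| \<le>o continuum" .
  then show ?thesis by (rule ordLeq_transitive[OF card_of_mono1[OF subset_UNIV]])
qed

lemma preceq_mono:
  assumes "preceq l F G I J" and "l \<le>o k"
  shows "preceq k F G I J"
  unfolding preceq_def
proof (intro allI impI)
  fix J' assume "ideal J' \<and> le_via G J J'"
  then obtain A :: "nat set set" where "|A| <o l" "UNIV \<notin> extend J' A" "le_via F I (extend J' A)"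
    using assms(1) unfolding preceq_def by blast
  then show "\<exists>A :: nat set set. |A| <o k \<and> UNIV \<notin> extend J' A \<and> le_via F I (extend J' A)"
    using ordLess_ordLeq_trans[OF _ assms(2)] by blast
qed

text \<open>The minimum ranges over cardinals represented on one fixed type, so
  \<^term>\<open>|F|\<close> has to be replaced by an isomorphic copy on that type before it can be compared
  with the minimum.\<close>

lemma less_u_card_iff:
  "|F| <o u_card I F J G \<longleftrightarrow> \<not> preceq |F| F G I J"
proof -
  let ?u = "u_card I F J G"
  let ?S = "{l. Card_order l \<and> l \<le>o continuum \<and> preceq l F G I J} \<union> {cardSuc continuum}"
  have S: "?S \<noteq> {}" "\<forall>l\<in>?S. Card_order l"
    using cardSuc_Card_order[OF card_of_Card_order] by auto
  note u_in = min_card_least(1)[OF S, folded u_card_def]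
  note u_least = min_card_least(2)[OF S, folded u_card_def]
  have F: "|F| \<le>o continuum" by (rule card_of_functions_le_continuum)
  have F_less: "|F| <o cardSuc continuum"
    using F cardSuc_greater[OF card_of_Card_order] ordLeq_ordLess_trans by blast
  have "?u \<le>o |F| \<longleftrightarrow> preceq |F| F G I J"
  proof
    assume le: "?u \<le>o |F|"
    then have "?u \<noteq> cardSuc continuum" using F_less not_ordLess_ordLeq by metis
    then have "preceq ?u F G I J" using u_in by blast
    then show "preceq |F| F G I J" using le by (rule preceq_mono)
  next
    assume preceq: "preceq |F| F G I J"
    obtain l :: "nat set set rel" where l: "Card_order l" "l =o |F|"
      using cardinal_le_representable[OF card_of_Card_order ordLess_imp_ordLeq[OF F_less]] by blast
    have "l \<le>o continuum" using l(2) F by (rule ordIso_ordLeq_trans)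
    moreover have "preceq l F G I J"
      using preceq by (rule preceq_mono) (use l(2) ordIso_iff_ordLeq in blast)
    ultimately have "?u \<le>o l" using l(1) u_least by blast
    then show "?u \<le>o |F|" using l(2) by (rule ordLeq_ordIso_trans)
  qed
  moreover have "Well_order ?u" using u_in S(2) card_order_on_well_order_on by blast
  ultimately show ?thesis
    using not_ordLeq_iff_ordLess[OF card_of_Well_order] by blast
qed

section \<open>The diagonalization\<close>

text \<open>A failure of properness is witnessed by finitely many of the adjoined sets. The one
  with the largest index would then have its complement in the ideal generated by the earlier
  ones, so properness never gets lost, at limit stages in particular.\<close>

lemma extend_image_proper:
  assumes K: "ideal K" and lin: "Linear_order r" and D: "D \<subseteq> Field r"
    and step: "\<And>x. x \<in> D \<Longrightarrow> - a x \<notin> extend K (a ` underS r x)"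
  shows "UNIV \<notin> extend K (a ` D)"
proof
  assume "UNIV \<in> extend K (a ` D)"
  then obtain T where T: "finite T" "T \<subseteq> D" "UNIV - \<Union>(a ` T) \<in> K"
    unfolding extend_def by (smt (verit) finite_subset_image mem_Collect_eq)
  have "T \<noteq> {}" using T(3) K unfolding ideal_def by auto
  have anti: "antisym r" and trans: "trans r" and total: "total_on (Field r) r"
    using lin by (auto simp: order_on_defs)
  have "\<exists>m\<in>T. \<forall>x\<in>T. x \<noteq> m \<longrightarrow> \<not> (m, x) \<in> r - Id"
  proof (rule Finite_Set.bex_max_element[OF T(1) _ _ \<open>T \<noteq> {}\<close>])
    show "asymp_on T (\<lambda>x y. (x, y) \<in> r - Id)"
      using anti by (auto simp: asymp_on_def antisym_def)
    show "transp_on T (\<lambda>x y. (x, y) \<in> r - Id)"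
      using anti trans by (auto simp: transp_on_def antisym_def trans_def)
  qed
  then obtain m where m: "m \<in> T" "\<And>x. x \<in> T \<Longrightarrow> x \<noteq> m \<Longrightarrow> (m, x) \<notin> r" by blast
  have "T - {m} \<subseteq> underS r m"
    using m total T(2) D unfolding underS_def total_on_def by blast
  moreover have "- a m - \<Union>(a ` (T - {m})) = UNIV - \<Union>(a ` T)" using m(1) by blast
  ultimately have "- a m \<in> extend K (a ` underS r m)"
    using T(1,3) unfolding extend_def by (auto intro!: exI[of _ "a ` (T - {m})"])
  then show False using step m(1) T(2) by blast
qed

text \<open>The sets are chosen by recursion along a well-order of type \<^term>\<open>|F|\<close>: its proper
  initial segments have size less than \<^term>\<open>|F|\<close>, so the hypothesis applies to the sets
  chosen so far.\<close>

lemma diagonal_family: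
  assumes K: "ideal K"
    and not_le: "\<And>A. |A| <o |F| \<Longrightarrow> UNIV \<notin> extend K A \<Longrightarrow> \<not> le_via F I (extend K A)"
  obtains a where "UNIV \<notin> extend K (a ` F)" "\<And>f. f \<in> F \<Longrightarrow> \<exists>B\<in>I. a f = - (f -` B)"
proof -
  let ?r = "|F|"
  have field: "Field ?r = F" by (rule Field_card_of)
  have wo: "Well_order ?r" by (rule card_of_Well_order)
  then have lin: "Linear_order ?r" and wf: "wf (?r - Id)" by (auto simp: well_order_on_def)
  let ?P = "\<lambda>a f X. f \<in> F \<longrightarrow>
    (\<exists>B\<in>I. X = - (f -` B) \<and> - X \<notin> extend K (a ` underS ?r f))"
  have "\<exists>a. \<forall>f. ?P a f (a f)"
  proof (rule dependent_wf_choice[OF wf])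
    fix a b :: "(nat \<Rightarrow> nat) \<Rightarrow> nat set" and f X
    assume "\<And>g. (g, f) \<in> ?r - Id \<Longrightarrow> a g = b g"
    then have "a ` underS ?r f = b ` underS ?r f" by (intro image_cong) (auto simp: underS_def)
    then show "?P a f X = ?P b f X" by simp
  next
    fix f and a :: "(nat \<Rightarrow> nat) \<Rightarrow> nat set"
    assume IH: "\<And>g. (g, f) \<in> ?r - Id \<Longrightarrow> ?P a g (a g)"
    show "\<exists>X. ?P a f X"
    proof (cases "f \<in> F")
      case True
      have under: "underS ?r f \<subseteq> F" using field by (auto simp: underS_def Field_def)
      have "|a ` underS ?r f| <o ?r"
        using card_of_image[of a "underS ?r f"] card_of_underS[OF card_of_Card_order] True field
          ordLeq_ordLess_trans by metis
      moreover have "UNIV \<notin> extend K (a ` underS ?r f)"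
      proof (rule extend_image_proper[OF K lin])
        show "underS ?r f \<subseteq> Field ?r" using under field by simp
        fix g assume "g \<in> underS ?r f"
        then show "- a g \<notin> extend K (a ` underS ?r g)"
          using IH[of g] under by (auto simp: underS_def)
      qed
      ultimately have "\<not> le_via F I (extend K (a ` underS ?r f))" by (rule not_le)
      then obtain B where "B \<in> I" "f -` B \<notin> extend K (a ` underS ?r f)"
        using True unfolding le_via_def by blast
      then show ?thesis by (intro exI[of _ "- (f -` B)"]) auto
    qed simp
  qed
  then obtain a where a: "\<And>f. ?P a f (a f)" by blast
  show thesis
  proof (rule that)
    show "UNIV \<notin> extend K (a ` F)"
      by (rule extend_image_proper[OF K lin]) (use a field in auto)
    show "\<exists>B\<in>I. a f = - (f -` B)" if "f \<in> F" for f
      using a that by blast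
  qed
qed

section \<open>The characterization by ultrafilters\<close>

theorem theorem3p4:
  fixes I J :: "nat set set" and F G :: "(nat \<Rightarrow> nat) set"
  assumes "ideal I" and "ideal J" and "id \<in> G"
  shows "|F| <o u_card I F J G \<longleftrightarrow>
    (\<exists>U. ultrafilter U \<and> \<not> le_via F I (dual U) \<and> le_via G J (dual U))"
  unfolding less_u_card_iff
proof
  assume "\<not> preceq |F| F G I J"
  then obtain J' where J': "ideal J'" "le_via G J J'"
    and not_le: "\<And>A. |A| <o |F| \<Longrightarrow> UNIV \<notin> extend J' A \<Longrightarrow> \<not> le_via F I (extend J' A)"
    unfolding preceq_def by blast
  obtain a where proper: "UNIV \<notin> extend J' (a ` F)"
    and a: "\<And>f. f \<in> F \<Longrightarrow> \<exists>B\<in>I. a f = - (f -` B)"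
    using diagonal_family[OF J'(1) not_le] by blast
  obtain U where U: "ultrafilter U" "extend J' (a ` F) \<subseteq> dual U"
    using ideal_below_dual_ultrafilter[OF ideal_extend[OF J'(1) proper]] .
  have "\<exists>B\<in>I. f -` B \<notin> dual U" if "f \<in> F" for f
  proof -
    from a[OF that] obtain B where B: "B \<in> I" "a f = - (f -` B)" by blast
    have "a f \<in> dual U"
      using family_subset_extend[OF J'(1), of "a ` F"] U(2) that by blast
    then have "f -` B \<in> U" using B(2) by simp
    then have "- (f -` B) \<notin> U" using U(1) unfolding ultrafilter_def by (metis Compl_disjoint)
    then show ?thesis using B(1) by auto
  qed
  then have "\<not> le_via F I (dual U)" unfolding le_via_def by blast
  moreover have "le_via G J (dual U)"
    using J'(2) extend_superset[OF J'(1)] U(2) unfolding le_via_def by blast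
  ultimately show "\<exists>U. ultrafilter U \<and> \<not> le_via F I (dual U) \<and> le_via G J (dual U)"
    using U(1) by blast
next
  assume "\<exists>U. ultrafilter U \<and> \<not> le_via F I (dual U) \<and> le_via G J (dual U)"
  then obtain U where U: "ultrafilter U" "\<not> le_via F I (dual U)" "le_via G J (dual U)"
    by blast
  have "extend (dual U) A = dual U" if "UNIV \<notin> extend (dual U) A" for A
    using dual_ultrafilter_maximal[OF U(1) ideal_extend[OF ideal_dual[OF U(1)] that]
      extend_superset[OF ideal_dual[OF U(1)]]] .
  then show "\<not> preceq |F| F G I J"
    using U ideal_dual[OF U(1)] unfolding preceq_def by metis
qed

end
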